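(* Let $\kappa\leq\lambda$ be infinite cardinals with $\kappa$ regular, let $X\subseteq{}^{\kappa}\lambda$ be a subspace of weight at most $\lambda$, and let $\mathbb{S}$ be a positively totally ordered monoid equipped with the infinitary sum $\sum$. Let $(X,\mathfrak{M},\mu)$ be a continuous weak $\lambda^+$-measure space, with $\mu$ taking values in $(\mathbb{S},\sum)$, such that $\mathfrak{M}$ is closed under finite intersections. Then there is a clopen partition $\mathcal{P}$ of $X$ such that $(P,\mathfrak{M}\downarrow P,\mu\downarrow P)$ is an $\omega_1$-Dirac, continuous, weak $\lambda^+$-measure space for every $P\in\mathcal{P}$, and $\mu$ is the sum of $(\mu\downarrow P)_{P\in\mathcal{P}}$, i.e., for every $M\in\mathfrak{M}$ we have \[\mu(M)=\sum_{P\in\mathcal{P}}(\mu\downarrow P)(M\cap P).\]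
   Context: **Topology.** ${}^{\kappa}\lambda$ is the set of sequences of elements of $\lambda$ of length $\kappa$, with the bounded topology, generated by the cones $\mathbf{N}_s=\{x\in{}^{\kappa}\lambda\mid s\subseteq x\}$ for $s\in{}^{<\kappa}\lambda=\bigcup_{\alpha<\kappa}{}^{\alpha}\lambda$. Subsets carry the subspace topology. **Monoids and sums.** A positively totally ordered monoid is $\mathbb{S}=(S,0,+,\leq)$ where $+$ is associative (not necessarily commutative) with neutral element $0$, $\leq$ is a total order, $a\leq b$ and $c\leq d$ imply $a+c\leq b+d$, $0$ is the minimum of $\leq$, and $S\neq\{0\}$. The infinitary sum $\sum$ on $\mathbb{S}$ is the partial function on sequences of elements of $S$ of arbitrary ordinal length given by $\sum(s)=\sup\{s_{\alpha_0}+\dots+s_{\alpha_k}\mid\alpha_0<\dots<\alpha_k<\gamma\}$ for $s=\langle s_\alpha\mid\alpha<\gamma\rangle$, defined exactly when this supremum exists in $\mathbb{S}$. A sum $\sum_{P\in\mathcal{P}}$ over a set of size $\leq\lambda$ is computed along an enumeration of $\mathcal{P}$ of length $<\lambda^+$. **Measures.** A weakly $\lambda^+$-measurable space is a pair $(X,\mathfrak{M})$ where $X$ is a topological space and $\mathfrak{M}$ is a family of subsets of $X$ closed under unions of size $\leq\lambda$ and containing all open subsets of $X$. A $\lambda^+$-measure on it (with values in $(\mathbb{S},\sum)$) is a partial function $\mu:\mathscr{P}(X)\to\mathbb{S}$ with $\mathfrak{M}\subseteq\mathrm{dom}(\mu)$ such that: (M1) $\mu(\emptyset)=0$; (M2)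 $\mu(X)>0$; (M3) $A\subseteq B$ implies $\mu(A)\leq\mu(B)$ for all $A,B\in\mathfrak{M}$; (M4) for every family $(A_i)_{i<\gamma}$ of pairwise disjoint sets of $\mathfrak{M}$ of length an ordinal $\gamma<\lambda^+$, we have $\langle\mu(A_i)\mid i<\gamma\rangle\in\mathrm{dom}(\sum)$ and $\mu(\bigcup_{i<\gamma}A_i)=\sum_{i<\gamma}\mu(A_i)$; (M5) for every $x\in X$ with $\{x\}\in\mathfrak{M}$ and every open local basis $\{A_i\mid i<\gamma\}$ at $x$ with $\gamma<\lambda^+$, $\mu(\{x\})=\inf_{i<\gamma}\mu(A_i)$. Then $(X,\mathfrak{M},\mu)$ is called a weak $\lambda^+$-measure space. It is continuous if $\{x\}\in\mathfrak{M}$ and $\mu(\{x\})=0$ for every $x\in X$. The support of $\mu$ is $\mathrm{supp}(\mu)=X\setminus\bigcup\{O\mid O\text{ open},\ \mu(O)=0\}$. For a cardinal $\gamma$, $\mu$ is $\gamma$-Dirac if $\mathrm{supp}(\mu)$ has weight strictly less than $\gamma$. **Restriction.** For $Y\subseteq X$, $\mathfrak{M}\downarrow Y=\{M\cap Y\mid M\in\mathfrak{M}\}$, and $\mu\downarrow Y$ is the partial function given by $(\mu\downarrow Y)(A)=\inf\{\mu(M)\mid M\in\mathfrak{M},\ M\cap Y=A\}$ for all $A\in\mathfrak{M}\downarrow Y$ for which this infimum exists. *)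

theory Defs
  imports "HOL-Analysis.Analysis" "HOL-Library.Lub_Glb"
begin

unbundle cardinal_syntax

text \<open>
  Cardinals are cardinal orders (\<open>Card_order\<close>) and ordinals are well-orders, both given as
  relations. We write \<open>\<Lambda>\<close> for the cardinal \<open>lambda\<close>, whose usual symbol is reserved.
  An ordinal below \<open>\<Lambda>\<^sup>+\<close> is a well-order \<open>w <o cardSuc \<Lambda>\<close>. If \<open>\<Lambda> :: 'l rel\<close>, then \<open>w\<close> also ranges
  over \<open>'l rel\<close>; this is no restriction, since every ordinal below \<open>\<Lambda>\<^sup>+\<close> has cardinality at
  most \<open>\<Lambda>\<close> and is therefore the order type of a well-order on a subset of \<open>Field \<Lambda>\<close>.
  A sequence of length \<open>w\<close> is a function of which only the values on \<open>Field w\<close> matter.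
\<close>

section \<open>Topology\<close>

definition is_base :: "'a topology \<Rightarrow> 'a set set \<Rightarrow> bool" where
  "is_base T \<B> \<longleftrightarrow>
     (\<forall>B\<in>\<B>. openin T B) \<and> (\<forall>U. openin T U \<longrightarrow> (\<exists>\<B>'. \<B>' \<subseteq> \<B> \<and> \<Union>\<B>' = U))"

text \<open>A minimum exists, since cardinals are well-ordered.\<close>

definition weight :: "'a topology \<Rightarrow> 'a set rel" where
  "weight T = |SOME \<B>. is_base T \<B> \<and> (\<forall>\<B>'. is_base T \<B>' \<longrightarrow> |\<B>| \<le>o |\<B>'| )|"

definition is_open_local_base :: "'a topology \<Rightarrow> 'a \<Rightarrow> 'a set set \<Rightarrow> bool" where
  "is_open_local_base T x \<B> \<longleftrightarrow>
     (\<forall>B\<in>\<B>. openin T B \<and> x \<in> B) \<and> (\<forall>U. openin T U \<and> x \<in> U \<longrightarrow> (\<exists>B\<in>\<B>. B \<subseteq> U))"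

definition seqs :: "'k rel \<Rightarrow> 'l rel \<Rightarrow> ('k \<Rightarrow> 'l) set" where
  "seqs \<kappa> \<Lambda> = Field \<kappa> \<rightarrow>\<^sub>E Field \<Lambda>"

text \<open>
  The ordinals \<open>\<alpha> < \<kappa>\<close> are the proper initial segments \<open>underS \<kappa> a\<close> with \<open>a \<in> Field \<kappa>\<close>, so
  the sequences of length less than \<open>\<kappa>\<close> are the \<open>s \<in> underS \<kappa> a \<rightarrow>\<^sub>E Field \<Lambda>\<close>.
\<close>

definition seq_cone :: "'k rel \<Rightarrow> 'l rel \<Rightarrow> 'k \<Rightarrow> ('k \<Rightarrow> 'l) \<Rightarrow> ('k \<Rightarrow> 'l) set" where
  "seq_cone \<kappa> \<Lambda> a s = {x \<in> seqs \<kappa> \<Lambda>. \<forall>b\<in>underS \<kappa> a. x b = s b}"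

definition bounded_topology :: "'k rel \<Rightarrow> 'l rel \<Rightarrow> ('k \<Rightarrow> 'l) topology" where
  "bounded_topology \<kappa> \<Lambda> =
     topology_generated_by
       {seq_cone \<kappa> \<Lambda> a s |a s. a \<in> Field \<kappa> \<and> s \<in> underS \<kappa> a \<rightarrow>\<^sub>E Field \<Lambda>}"


section \<open>Monoids and infinitary sums\<close>

text \<open>Addition need not be commutative.\<close>

class pos_tot_ord_monoid = monoid_add + linorder +
  assumes add_mono_both: "a \<le> b \<Longrightarrow> c \<le> d \<Longrightarrow> a + c \<le> b + d"
    and zero_least: "0 \<le> a"
    and nontrivial: "\<exists>a. a \<noteq> 0"

text \<open>Suprema, infima and sums are partial; \<open>None\<close> means undefined.\<close>

definition sup_opt :: "'s::linorder set \<Rightarrow> 's option" where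
  "sup_opt A = (if \<exists>a. isLub UNIV A a then Some (THE a. isLub UNIV A a) else None)"

definition inf_opt :: "'s::linorder set \<Rightarrow> 's option" where
  "inf_opt A = (if \<exists>a. isGlb UNIV A a then Some (THE a. isGlb UNIV A a) else None)"

definition osum :: "'i rel \<Rightarrow> ('i \<Rightarrow> 's::pos_tot_ord_monoid) \<Rightarrow> 's option" where
  "osum w s =
     sup_opt {sum_list (map s as) |as.
       as \<noteq> [] \<and> set as \<subseteq> Field w \<and> sorted_wrt (\<lambda>\<alpha> \<beta>. (\<alpha>, \<beta>) \<in> w \<and> \<alpha> \<noteq> \<beta>) as}"

text \<open>
  \<open>a\<close> is the sum of \<open>f\<close> over the set \<open>\<P>\<close> of size at most \<open>\<Lambda>\<close>. As \<open>+\<close> need not commute,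
  this is required along every enumeration of \<open>\<P>\<close> of length below \<open>\<Lambda>\<^sup>+\<close>.
\<close>

definition is_set_sum ::
  "'l rel \<Rightarrow> ('p \<Rightarrow> 's::pos_tot_ord_monoid) \<Rightarrow> 'p set \<Rightarrow> 's \<Rightarrow> bool" where
  "is_set_sum \<Lambda> f \<P> a \<longleftrightarrow>
     |\<P>| \<le>o \<Lambda> \<and>
     (\<forall>(w::'l rel) e. w <o cardSuc \<Lambda> \<and> bij_betw e (Field w) \<P> \<longrightarrow> osum w (f \<circ> e) = Some a)"


section \<open>Measures\<close>

definition weakly_measurable_space :: "'l rel \<Rightarrow> 'x topology \<Rightarrow> 'x set set \<Rightarrow> bool" where
  "weakly_measurable_space \<Lambda> T \<MM> \<longleftrightarrow>
     \<MM> \<subseteq> Pow (topspace T) \<and>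
     (\<forall>\<A>. \<A> \<subseteq> \<MM> \<and> |\<A>| \<le>o \<Lambda> \<longrightarrow> \<Union>\<A> \<in> \<MM>) \<and>
     (\<forall>U. openin T U \<longrightarrow> U \<in> \<MM>)"

definition is_measure ::
  "'l rel \<Rightarrow> 'x topology \<Rightarrow> 'x set set \<Rightarrow> ('x set \<rightharpoonup> 's::pos_tot_ord_monoid) \<Rightarrow> bool" where
  "is_measure \<Lambda> T \<MM> \<mu> \<longleftrightarrow>
     dom \<mu> \<subseteq> Pow (topspace T) \<and> \<MM> \<subseteq> dom \<mu> \<and>
     \<comment> \<open>M1\<close> \<mu> {} = Some 0 \<and>
     \<comment> \<open>M2\<close> the (\<mu> (topspace T)) > 0 \<and>
     \<comment> \<open>M3\<close> (\<forall>A\<in>\<MM>. \<forall>B\<in>\<MM>. A \<subseteq> B \<longrightarrow> the (\<mu> A) \<le> the (\<mu> B)) \<and>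
     \<comment> \<open>M4\<close> (\<forall>(w::'l rel) A.
        w <o cardSuc \<Lambda> \<and> (\<forall>i\<in>Field w. A i \<in> \<MM>) \<and> disjoint_family_on A (Field w) \<longrightarrow>
        osum w (\<lambda>i. the (\<mu> (A i))) \<noteq> None \<and>
        \<mu> (\<Union>i\<in>Field w. A i) = osum w (\<lambda>i. the (\<mu> (A i)))) \<and>
     \<comment> \<open>M5\<close> (\<forall>x\<in>topspace T. \<forall>(w::'l rel) A.
        {x} \<in> \<MM> \<and> w <o cardSuc \<Lambda> \<and> is_open_local_base T x (A ` Field w) \<longrightarrow>
        \<mu> {x} = inf_opt {the (\<mu> (A i)) |i. i \<in> Field w})"

definition weak_measure_space ::
  "'l rel \<Rightarrow> 'x topology \<Rightarrow> 'x set set \<Rightarrow> ('x set \<rightharpoonup> 's::pos_tot_ord_monoid) \<Rightarrow> bool" where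
  "weak_measure_space \<Lambda> T \<MM> \<mu> \<longleftrightarrow> weakly_measurable_space \<Lambda> T \<MM> \<and> is_measure \<Lambda> T \<MM> \<mu>"

definition continuous_measure ::
  "'x topology \<Rightarrow> 'x set set \<Rightarrow> ('x set \<rightharpoonup> 's::pos_tot_ord_monoid) \<Rightarrow> bool" where
  "continuous_measure T \<MM> \<mu> \<longleftrightarrow> (\<forall>x\<in>topspace T. {x} \<in> \<MM> \<and> \<mu> {x} = Some 0)"

definition measure_supp :: "'x topology \<Rightarrow> ('x set \<rightharpoonup> 's::pos_tot_ord_monoid) \<Rightarrow> 'x set" where
  "measure_supp T \<mu> = topspace T - \<Union>{U. openin T U \<and> \<mu> U = Some 0}"

definition Dirac_measure ::
  "'c rel \<Rightarrow> 'x topology \<Rightarrow> ('x set \<rightharpoonup> 's::pos_tot_ord_monoid) \<Rightarrow> bool" where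
  "Dirac_measure \<gamma> T \<mu> \<longleftrightarrow> weight (subtopology T (measure_supp T \<mu>)) <o \<gamma>"

definition restrict_sets :: "'x set set \<Rightarrow> 'x set \<Rightarrow> 'x set set" where
  "restrict_sets \<MM> Y = {M \<inter> Y |M. M \<in> \<MM>}"

definition restrict_measure ::
  "'x set set \<Rightarrow> ('x set \<rightharpoonup> 's::pos_tot_ord_monoid) \<Rightarrow> 'x set \<Rightarrow> ('x set \<rightharpoonup> 's)" where
  "restrict_measure \<MM> \<mu> Y =
     (\<lambda>A. if A \<in> restrict_sets \<MM> Y then inf_opt {the (\<mu> M) |M. M \<in> \<MM> \<and> M \<inter> Y = A} else None)"

end

theory Submission
  imports Defs
begin

text \<open>
  Every point has arbitrarily small cones, so for \<open>c > 0\<close> the maximal cones of measure at most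
  \<open>c\<close> partition \<open>X\<close> into at most \<open>\<lambda>\<close> pieces. This yields some \<open>\<epsilon> > 0\<close> such that every \<open>d > 0\<close>
  has a finite multiple above \<open>\<epsilon>\<close>. A set of measure at most \<open>\<epsilon>\<close> then contains only finitely
  many disjoint pieces of measure at least \<open>d\<close>; in particular \<open>0\<close> is the limit of a countable
  set of positive elements, so only countably many disjoint pieces have positive measure. Hence the
  support of each cone of measure at most \<open>\<epsilon>\<close> is second countable. The null cones are merged into
  one positive piece, because every piece must have positive measure.
\<close>

section \<open>Bases and weight\<close>

lemma is_baseD_nbhd:
  assumes "is_base T \<B>" "openin T U" "x \<in> U"
  obtains B where "B \<in> \<B>" "x \<in> B" "B \<subseteq> U"
proof -
  obtain \<B>' where "\<B>' \<subseteq> \<B>" "\<Union>\<B>' = U"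
    using assms by (auto simp: is_base_def)
  then show ?thesis using that \<open>x \<in> U\<close> by blast
qed

lemma is_baseI:
  assumes "\<And>B. B \<in> \<B> \<Longrightarrow> openin T B"
    and "\<And>U x. openin T U \<Longrightarrow> x \<in> U \<Longrightarrow> \<exists>B\<in>\<B>. x \<in> B \<and> B \<subseteq> U"
  shows "is_base T \<B>"
  unfolding is_base_def
proof (intro conjI ballI allI impI)
  fix U assume "openin T U"
  then have "\<Union>{B\<in>\<B>. B \<subseteq> U} = U" using assms(2) by blast
  then show "\<exists>\<B>'\<subseteq>\<B>. \<Union>\<B>' = U" by (intro exI[of _ "{B\<in>\<B>. B \<subseteq> U}"]) auto
qed (use assms(1) in auto)

text \<open>The cardinals of bases are well-ordered, so the choice in \<open>weight\<close> has a
  witness. The definition of \<open>weight\<close> is used only through this lemma.\<close>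

lemma weight_minimal_base:
  obtains \<B> where "is_base T \<B>" "weight T = |\<B>|" "\<And>\<B>'. is_base T \<B>' \<Longrightarrow> weight T \<le>o |\<B>'|"
proof -
  let ?R = "{|\<B>| |\<B>. is_base T \<B>}"
  have "is_base T {U. openin T U}" by (rule is_baseI) auto
  then have "?R \<noteq> {}" by blast
  moreover have "\<forall>r\<in>?R. Card_order r" using card_of_Card_order by blast
  ultimately have "\<exists>r\<in>?R. \<forall>r'\<in>?R. r \<le>o r'" by (rule exists_minim_Card_order)
  then have "\<exists>\<B>. is_base T \<B> \<and> (\<forall>\<B>'. is_base T \<B>' \<longrightarrow> |\<B>| \<le>o |\<B>'| )" by blast
  from someI_ex[OF this] show ?thesis
    by (intro that) (auto simp: weight_def)
qed

text \<open>Choosing a nonempty base element inside each member is injective by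
  disjointness.\<close>

lemma card_disjoint_open_le_weight:
  assumes "\<And>C. C \<in> \<C> \<Longrightarrow> openin T C" "disjoint \<C>" "{} \<notin> \<C>"
  shows "|\<C>| \<le>o weight T"
proof -
  obtain \<B> where \<B>: "is_base T \<B>" "weight T = |\<B>|" using weight_minimal_base by metis
  have "\<exists>B. B \<in> \<B> \<and> B \<noteq> {} \<and> B \<subseteq> C" if "C \<in> \<C>" for C
  proof -
    obtain x where "x \<in> C" using \<open>{} \<notin> \<C>\<close> \<open>C \<in> \<C>\<close> by (metis all_not_in_conv)
    then show ?thesis using is_baseD_nbhd[OF \<B>(1) assms(1)[OF \<open>C \<in> \<C>\<close>]] by blast
  qed
  then obtain f where f: "\<And>C. C \<in> \<C> \<Longrightarrow> f C \<in> \<B> \<and> f C \<noteq> {} \<and> f C \<subseteq> C" by metis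
  have "inj_on f \<C>"
  proof (rule inj_onI)
    fix C D assume "C \<in> \<C>" "D \<in> \<C>" "f C = f D"
    then have "C \<inter> D \<noteq> {}" using f[of C] f[of D] by auto
    then show "C = D" using \<open>disjoint \<C>\<close> \<open>C \<in> \<C>\<close> \<open>D \<in> \<C>\<close> by (auto simp: disjoint_def)
  qed
  then show ?thesis unfolding \<B>(2) using f by (intro card_of_ordLeqI) auto
qed

section \<open>Partial suprema, infima and sums\<close>

lemma sup_opt_SomeD:
  assumes "sup_opt A = Some v"
  shows "isLub UNIV A v"
proof -
  obtain a where a: "isLub UNIV A a" and v: "v = (THE a. isLub UNIV A a)"
    using assms by (auto simp: sup_opt_def split: if_splits)
  have "(THE a. isLub UNIV A a) = a" using a by (rule the_equality) (rule isLub_unique[OF _ a])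
  then show ?thesis using a v by simp
qed

lemma inf_opt_SomeD:
  assumes "inf_opt A = Some v"
  shows "isGlb UNIV A v"
proof -
  obtain a where a: "isGlb UNIV A a" and v: "v = (THE a. isGlb UNIV A a)"
    using assms by (auto simp: inf_opt_def split: if_splits)
  have "(THE a. isGlb UNIV A a) = a" using a by (rule the_equality) (rule isGlb_unique[OF _ a])
  then show ?thesis using a v by simp
qed

lemma inf_opt_minimum:
  assumes "v \<in> A" "\<And>a. a \<in> A \<Longrightarrow> v \<le> a"
  shows "inf_opt A = Some v"
proof -
  have v: "isGlb UNIV A v"
    using assms by (auto simp: isGlb_def greatestP_def isLb_def setge_def setle_def)
  have "(THE a. isGlb UNIV A a) = v" using v by (rule the_equality) (rule isGlb_unique[OF _ v])
  then show ?thesis using v by (auto simp: inf_opt_def)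
qed

lemma osum_upper:
  assumes "osum w s = Some v" "as \<noteq> []" "set as \<subseteq> Field w"
    "sorted_wrt (\<lambda>\<alpha> \<beta>. (\<alpha>, \<beta>) \<in> w \<and> \<alpha> \<noteq> \<beta>) as"
  shows "sum_list (map s as) \<le> v"
  using assms unfolding osum_def by (intro isLubD2[OF sup_opt_SomeD]) auto

lemma osum_least:
  assumes "osum w s = Some v"
    and "\<And>as. as \<noteq> [] \<Longrightarrow> set as \<subseteq> Field w \<Longrightarrow>
      sorted_wrt (\<lambda>\<alpha> \<beta>. (\<alpha>, \<beta>) \<in> w \<and> \<alpha> \<noteq> \<beta>) as \<Longrightarrow> sum_list (map s as) \<le> b"
  shows "v \<le> b"
  using assms unfolding osum_def
  by (intro isLub_le_isUb[OF sup_opt_SomeD]) (auto intro!: isUb_UNIV_I)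

lemma osum_cong:
  assumes "\<And>i. i \<in> Field w \<Longrightarrow> f i = g i"
  shows "osum w f = osum w g"
proof -
  have "map f as = map g as" if "set as \<subseteq> Field w" for as
    using that assms by auto
  then have "sum_list (map f as) = sum_list (map g as)" if "set as \<subseteq> Field w" for as
    using that by metis
  then show ?thesis
    unfolding osum_def setcompr_eq_image by (intro arg_cong[where f=sup_opt] image_cong refl) simp
qed

lemma sum_list_le_replicate:
  fixes f :: "'i \<Rightarrow> 's::pos_tot_ord_monoid"
  assumes "\<And>i. i \<in> set as \<Longrightarrow> f i \<le> c"
  shows "sum_list (map f as) \<le> sum_list (replicate (length as) c)"
  using assms by (induction as) (auto intro: add_mono_both)

text \<open>Zero terms vanish on either side, so no commutativity is involved. Equality may fail
  because \<open>j\<close> need not occur in the list.\<close>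

lemma sum_list_le_single:
  fixes f :: "'i \<Rightarrow> 's::pos_tot_ord_monoid"
  assumes "distinct as" "\<And>i. i \<in> set as \<Longrightarrow> i \<noteq> j \<Longrightarrow> f i = 0"
  shows "sum_list (map f as) \<le> f j"
  using assms
proof (induction as)
  case (Cons i as)
  show ?case
  proof (cases "i = j")
    case True
    then have "map f as = map (\<lambda>_. 0) as" using Cons.prems by auto
    then have "sum_list (map f as) = 0" by (simp del: map_eq_conv)
    then show ?thesis using True by simp
  qed (use Cons in auto)
qed (simp add: zero_least)

lemma sum_list_replicate_0: "sum_list (replicate n (0::'a::monoid_add)) = 0"
  by (induction n) auto

text \<open>\<open>replicate\<close> unfolds by prepending a term; without commutativity the version
  that appends one has to be proved separately.\<close>

lemma sum_list_replicate_Suc: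
  fixes d :: "'a::monoid_add"
  shows "sum_list (replicate (Suc n) d) = sum_list (replicate n d) + d"
  by (simp add: replicate_append_same[symmetric] del: replicate_append_same)

section \<open>Weak measure spaces closed under intersections\<close>

locale weak_measure =
  fixes \<Lambda> :: "'l rel" and T :: "'x topology" and \<MM> :: "'x set set"
    and \<mu> :: "'x set \<rightharpoonup> 's::pos_tot_ord_monoid"
  assumes card_\<Lambda>: "Card_order \<Lambda>" and inf_\<Lambda>: "infinite (Field \<Lambda>)"
    and space: "weak_measure_space \<Lambda> T \<MM> \<mu>"
    and Int_sets: "A \<in> \<MM> \<Longrightarrow> B \<in> \<MM> \<Longrightarrow> A \<inter> B \<in> \<MM>"
begin

abbreviation m :: "'x set \<Rightarrow> 's" where "m A \<equiv> the (\<mu> A)"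

lemma sets_into_space: "A \<in> \<MM> \<Longrightarrow> A \<subseteq> topspace T"
  using space by (auto simp: weak_measure_space_def weakly_measurable_space_def)

lemma Union_sets: "\<A> \<subseteq> \<MM> \<Longrightarrow> |\<A>| \<le>o \<Lambda> \<Longrightarrow> \<Union>\<A> \<in> \<MM>"
  using space by (auto simp: weak_measure_space_def weakly_measurable_space_def)

lemma open_sets: "openin T U \<Longrightarrow> U \<in> \<MM>"
  using space by (auto simp: weak_measure_space_def weakly_measurable_space_def)

lemma mu_eq_Some: "A \<in> \<MM> \<Longrightarrow> \<mu> A = Some (m A)"
  using space by (auto simp: weak_measure_space_def is_measure_def)

lemma mu_empty: "\<mu> {} = Some 0"
  using space by (auto simp: weak_measure_space_def is_measure_def)

lemma m_space_pos: "0 < m (topspace T)"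
  using space by (auto simp: weak_measure_space_def is_measure_def)

lemma m_mono: "A \<in> \<MM> \<Longrightarrow> B \<in> \<MM> \<Longrightarrow> A \<subseteq> B \<Longrightarrow> m A \<le> m B"
  using space by (auto simp: weak_measure_space_def is_measure_def)

lemma mu_UN:
  fixes w :: "'l rel"
  assumes "w <o cardSuc \<Lambda>" "\<And>i. i \<in> Field w \<Longrightarrow> A i \<in> \<MM>" "disjoint_family_on A (Field w)"
  shows "osum w (\<lambda>i. m (A i)) \<noteq> None" "\<mu> (\<Union>i\<in>Field w. A i) = osum w (\<lambda>i. m (A i))"
  using space assms by (auto simp: weak_measure_space_def is_measure_def)

lemma mu_point:
  fixes w :: "'l rel"
  assumes "x \<in> topspace T" "{x} \<in> \<MM>" "w <o cardSuc \<Lambda>" "is_open_local_base T x (A ` Field w)"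
  shows "\<mu> {x} = inf_opt {m (A i) |i. i \<in> Field w}"
  using space assms by (auto simp: weak_measure_space_def is_measure_def)

section \<open>Index ordinals below the successor of \<open>\<Lambda>\<close>\<close>

lemma card_le_finite: "finite A \<Longrightarrow> |A| \<le>o \<Lambda>"
  by (metis card_\<Lambda> inf_\<Lambda> card_of_Field_ordIso card_of_Well_order card_of_ordLeq_finite
      ordLeq_ordIso_trans ordLeq_total)

text \<open>Sequences are indexed by well-orders of type \<open>'l rel\<close>, so the set is first
  injected into \<open>Field \<Lambda>\<close>; the cardinal order of its image serves as the index
  ordinal.\<close>

lemma enumeration:
  assumes "|A| \<le>o \<Lambda>"
  obtains w :: "'l rel" and e where "w <o cardSuc \<Lambda>" "bij_betw e (Field w) A"
proof -
  have "|A| \<le>o |Field \<Lambda>|"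
    using assms card_of_Field_ordIso[OF card_\<Lambda>] ordIso_symmetric ordLeq_ordIso_trans by blast
  then obtain f where f: "inj_on f A" "f ` A \<subseteq> Field \<Lambda>"
    unfolding card_of_ordLeq[symmetric] by blast
  have "|f ` A| <o cardSuc \<Lambda>"
    using ordLeq_transitive[OF card_of_image assms]
    by (subst cardSuc_ordLeq_ordLess[OF card_\<Lambda> card_of_Card_order]) blast
  moreover have "bij_betw (inv_into A f) (Field |f ` A| ) A"
    using f(1) by (simp add: Field_card_of bij_betw_imageI bij_betw_inv_into)
  ultimately show ?thesis using that by blast
qed

lemma card_Field_le:
  fixes w :: "'l rel"
  assumes "w <o cardSuc \<Lambda>"
  shows "|Field w| \<le>o \<Lambda>"
proof -
  have "Well_order w" using assms by (auto simp: ordLess_def)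
  then have "|Field w| <o cardSuc \<Lambda>" using card_of_least assms ordLeq_ordLess_trans by blast
  then show ?thesis using cardSuc_ordLeq_ordLess[OF card_\<Lambda> card_of_Card_order] by blast
qed

section \<open>Bounds on disjoint unions\<close>

text \<open>By M4 the measure of the union is a supremum of finite sums along some enumeration.
  Bounding the sums of all lists without repetition covers every order in which that enumeration may
  add the terms.\<close>

lemma m_Union_le:
  assumes "\<A> \<subseteq> \<MM>" "disjoint \<A>" "|\<A>| \<le>o \<Lambda>"
    and "\<And>as. as \<noteq> [] \<Longrightarrow> distinct as \<Longrightarrow> set as \<subseteq> \<A> \<Longrightarrow> sum_list (map m as) \<le> b"
  shows "m (\<Union>\<A>) \<le> b"
proof -
  obtain w :: "'l rel" and e where w: "w <o cardSuc \<Lambda>" and e: "bij_betw e (Field w) \<A>"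
    using enumeration[OF assms(3)] .
  have img: "e ` Field w = \<A>" and inj: "inj_on e (Field w)" using e by (auto simp: bij_betw_def)
  have "disjoint_family_on e (Field w)"
    unfolding disjoint_family_on_def
    using img inj assms(2) by (metis disjointD imageI inj_onD)
  moreover have "e i \<in> \<MM>" if "i \<in> Field w" for i using that img assms(1) by blast
  ultimately have "osum w (\<lambda>i. m (e i)) = \<mu> (\<Union>\<A>)" using mu_UN(2)[OF w] img by metis
  also have "\<dots> = Some (m (\<Union>\<A>))" using assms by (intro mu_eq_Some Union_sets)
  finally show ?thesis
  proof (rule osum_least)
    fix as assume as: "as \<noteq> []" "set as \<subseteq> Field w" "sorted_wrt (\<lambda>\<alpha> \<beta>. (\<alpha>, \<beta>) \<in> w \<and> \<alpha> \<noteq> \<beta>) as"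
    have "distinct as"
      using as(3) by (auto simp: distinct_conv_nth sorted_wrt_iff_nth_less) (metis nat_neq_iff)
    then have "distinct (map e as)" using as(2) inj by (auto simp: distinct_map intro: inj_on_subset)
    then have "sum_list (map m (map e as)) \<le> b"
      using as img by (intro assms(4)) auto
    then show "sum_list (map (\<lambda>i. m (e i)) as) \<le> b" by (simp add: comp_def)
  qed
qed

text \<open>Finite sums of measures at most \<open>c\<close> stay below multiples of
  \<open>c\<close>. This is meant for \<open>c = 0\<close> and for \<open>c\<close> infinitesimal
  relative to \<open>b\<close>.\<close>

lemma m_Union_le_replicate:
  assumes "\<A> \<subseteq> \<MM>" "disjoint \<A>" "|\<A>| \<le>o \<Lambda>" "\<And>A. A \<in> \<A> \<Longrightarrow> m A \<le> c"
    and "\<And>n. sum_list (replicate n c) \<le> b"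
  shows "m (\<Union>\<A>) \<le> b"
proof (rule m_Union_le[OF assms(1-3)])
  fix as assume "set as \<subseteq> \<A>"
  then have "sum_list (map m as) \<le> sum_list (replicate (length as) c)"
    using assms(4) by (intro sum_list_le_replicate) auto
  then show "sum_list (map m as) \<le> b" using assms(5) order_trans by blast
qed

lemma m_Union_null:
  assumes "\<A> \<subseteq> \<MM>" "disjoint \<A>" "|\<A>| \<le>o \<Lambda>" "\<And>A. A \<in> \<A> \<Longrightarrow> m A = 0"
  shows "m (\<Union>\<A>) = 0"
proof -
  have "m (\<Union>\<A>) \<le> 0"
    by (rule m_Union_le_replicate[OF assms(1-3), where c=0])
      (simp_all add: assms(4) sum_list_replicate_0)
  then show ?thesis using zero_least by (rule order_antisym)
qed

lemma Un_sets: "A \<in> \<MM> \<Longrightarrow> B \<in> \<MM> \<Longrightarrow> A \<union> B \<in> \<MM>"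
  using Union_sets[of "{A, B}"] by (simp add: card_le_finite)

lemma m_Un_null:
  assumes "A \<in> \<MM>" "B \<in> \<MM>" "A \<inter> B = {}" "m B = 0"
  shows "m (A \<union> B) = m A"
proof (rule order_antisym)
  have "m (\<Union>{A, B}) \<le> m A"
  proof (rule m_Union_le)
    fix as assume "distinct as" "set as \<subseteq> {A, B}"
    then show "sum_list (map m as) \<le> m A"
      using assms by (intro sum_list_le_single) auto
  qed (use assms in \<open>auto simp: disjoint_def card_le_finite\<close>)
  then show "m (A \<union> B) \<le> m A" by simp
  show "m A \<le> m (A \<union> B)" using assms Un_sets by (intro m_mono) auto
qed

text \<open>M4 is applied to a two-element index set. The direction of its well-order is unknown and
  addition need not commute, so it is only known that one of the two sums is bounded.\<close>

lemma m_Un_ge: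
  assumes "A \<in> \<MM>" "B \<in> \<MM>" "A \<inter> B = {}"
  shows "m A + m B \<le> m (A \<union> B) \<or> m B + m A \<le> m (A \<union> B)"
proof -
  obtain a where a: "a \<in> Field \<Lambda>" using inf_\<Lambda> by (metis all_not_in_conv finite.emptyI)
  obtain b where b: "b \<in> Field \<Lambda>" "b \<noteq> a" using inf_\<Lambda> a
    by (metis finite.emptyI finite.insertI insertCI rev_finite_subset subsetI)
  define w where "w = |{a, b}|"
  have Fw: "Field w = {a, b}" by (simp add: w_def Field_card_of)
  have w: "w <o cardSuc \<Lambda>"
    unfolding w_def using card_le_finite[of "{a,b}"]
    by (subst cardSuc_ordLeq_ordLess[OF card_\<Lambda> card_of_Card_order]) blast
  define F where "F = (\<lambda>i. if i = a then A else B)"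
  have FA: "F a = A" "F b = B" using b by (auto simp: F_def)
  have "disjoint_family_on F (Field w)"
    using assms(3) b(2) by (auto simp: disjoint_family_on_def Fw FA)
  moreover have "F i \<in> \<MM>" for i using assms by (simp add: F_def)
  ultimately have "osum w (\<lambda>i. m (F i)) = \<mu> (\<Union>i\<in>Field w. F i)" using mu_UN(2)[OF w] by metis
  also have "(\<Union>i\<in>Field w. F i) = A \<union> B" by (simp add: Fw FA)
  finally have "osum w (\<lambda>i. m (F i)) = \<mu> (A \<union> B)" .
  then have o: "osum w (\<lambda>i. m (F i)) = Some (m (A \<union> B))"
    using mu_eq_Some[OF Un_sets[OF assms(1,2)]] by metis
  have "Well_order w" by (simp add: w_def card_of_Well_order)
  then have "(a, b) \<in> w \<or> (b, a) \<in> w"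
    using b(2) by (auto simp: well_order_on_def linear_order_on_def total_on_def Fw)
  then show ?thesis
    using osum_upper[OF o, of "[a, b]"] osum_upper[OF o, of "[b, a]"] b(2) by (auto simp: Fw FA)
qed

text \<open>With a single constant \<open>d\<close> both orders of addition give the same multiple,
  so the disjunction in \<open>m_Un_ge\<close> does no harm to the induction.\<close>

lemma replicate_le_m_Union:
  assumes "finite \<F>" "\<F> \<subseteq> \<MM>" "disjoint \<F>" "\<And>A. A \<in> \<F> \<Longrightarrow> d \<le> m A"
  shows "sum_list (replicate (card \<F>) d) \<le> m (\<Union>\<F>)"
  using assms
proof (induction rule: finite_induct)
  case empty
  show ?case using mu_empty by simp
next
  case (insert A \<F>)
  have IH: "sum_list (replicate (card \<F>) d) \<le> m (\<Union>\<F>)"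
    using insert.prems by (intro insert.IH) (auto simp: disjoint_def)
  have dA: "d \<le> m A" using insert.prems by simp
  have "A \<inter> \<Union>\<F> = {}" using insert by (fastforce simp: disjoint_def)
  moreover have "\<Union>\<F> \<in> \<MM>" using insert by (intro Union_sets card_le_finite) auto
  ultimately have "m A + m (\<Union>\<F>) \<le> m (\<Union>(insert A \<F>)) \<or> m (\<Union>\<F>) + m A \<le> m (\<Union>(insert A \<F>))"
    using m_Un_ge[of A "\<Union>\<F>"] insert.prems by simp
  moreover have "sum_list (replicate (Suc (card \<F>)) d) \<le> m A + m (\<Union>\<F>)"
    using add_mono_both[OF dA IH] by simp
  moreover have "sum_list (replicate (Suc (card \<F>)) d) \<le> m (\<Union>\<F>) + m A"
    unfolding sum_list_replicate_Suc by (rule add_mono_both[OF IH dA])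
  ultimately show ?case using insert.hyps by (auto intro: order_trans)
qed

text \<open>A subfamily of \<open>n\<close> members would already have a union of measure greater
  than \<open>m P\<close>.\<close>

lemma finite_disjoint_above:
  assumes "\<F> \<subseteq> \<MM>" "disjoint \<F>" "\<And>A. A \<in> \<F> \<Longrightarrow> d \<le> m A"
    and "P \<in> \<MM>" "\<Union>\<F> \<subseteq> P" "m P < sum_list (replicate n d)"
  shows "finite \<F>"
proof (rule ccontr)
  assume "infinite \<F>"
  then obtain \<G> where \<G>: "\<G> \<subseteq> \<F>" "finite \<G>" "card \<G> = n"
    using infinite_arbitrarily_large by blast
  have "sum_list (replicate n d) \<le> m (\<Union>\<G>)"
  proof -
    have "\<G> \<subseteq> \<MM>" "disjoint \<G>" using \<G> assms(1,2) pairwise_subset by blast+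
    then show ?thesis using replicate_le_m_Union[of \<G> d] \<G> assms(3) by blast
  qed
  also have "\<dots> \<le> m P"
    using \<G> assms(1,4,5) by (intro m_mono Union_sets card_le_finite) blast+
  finally show False using assms(6) by simp
qed

section \<open>Restriction to a piece\<close>

lemma restrict_sets_eq: "P \<in> \<MM> \<Longrightarrow> restrict_sets \<MM> P = {A \<in> \<MM>. A \<subseteq> P}"
  using Int_sets by (auto simp: restrict_sets_def)

text \<open>A measurable \<open>A\<close> inside \<open>P\<close> is itself a set with trace
  \<open>A\<close> and is contained in every other such set, so by monotonicity the infimum is a
  minimum.\<close>

lemma restrict_measure_eq:
  assumes "P \<in> \<MM>"
  shows "restrict_measure \<MM> \<mu> P A = (if A \<in> \<MM> \<and> A \<subseteq> P then \<mu> A else None)"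
proof (cases "A \<in> \<MM> \<and> A \<subseteq> P")
  case True
  then have "inf_opt {m M |M. M \<in> \<MM> \<and> M \<inter> P = A} = Some (m A)"
    using assms by (intro inf_opt_minimum) (auto intro!: m_mono)
  then show ?thesis
    using True mu_eq_Some[of A] assms by (simp only: restrict_measure_def restrict_sets_eq) auto
next
  case False
  then have "A \<notin> restrict_sets \<MM> P" using restrict_sets_eq[OF assms] by blast
  then show ?thesis using False by (auto simp: restrict_measure_def)
qed

text \<open>The restricted measure is \<open>\<mu>\<close> cut down to the measurable subsets of
  \<open>P\<close>, so the axioms are inherited, with \<open>0 < m P\<close> giving M2.\<close>

lemma weak_measure_space_restrict:
  assumes P: "openin T P" and pos: "0 < m P"
  shows "weak_measure_space \<Lambda> (subtopology T P) (restrict_sets \<MM> P) (restrict_measure \<MM> \<mu> P)"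
proof -
  have PM: "P \<in> \<MM>" and PX: "P \<subseteq> topspace T" using P open_sets openin_subset by auto
  let ?\<nu> = "restrict_measure \<MM> \<mu> P"
  have opens: "openin (subtopology T P) U \<longleftrightarrow> openin T U \<and> U \<subseteq> P" for U
    using P openin_open_subtopology by blast
  have \<nu>: "?\<nu> A = \<mu> A" if "A \<in> \<MM>" "A \<subseteq> P" for A using that restrict_measure_eq[OF PM] by simp
  have "weakly_measurable_space \<Lambda> (subtopology T P) {A \<in> \<MM>. A \<subseteq> P}"
    unfolding weakly_measurable_space_def
  proof (intro conjI allI impI; (elim conjE)?)
    show "{A \<in> \<MM>. A \<subseteq> P} \<subseteq> Pow (topspace (subtopology T P))" using PX by auto
    show "\<Union>\<A> \<in> {A \<in> \<MM>. A \<subseteq> P}" if "\<A> \<subseteq> {A \<in> \<MM>. A \<subseteq> P}" "|\<A>| \<le>o \<Lambda>" for \<A>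
      using that Union_sets[of \<A>] by blast
    show "U \<in> {A \<in> \<MM>. A \<subseteq> P}" if "openin (subtopology T P) U" for U
      using that by (simp add: opens open_sets)
  qed
  moreover have "is_measure \<Lambda> (subtopology T P) {A \<in> \<MM>. A \<subseteq> P} ?\<nu>"
    unfolding is_measure_def
  proof (intro conjI ballI allI impI; (elim conjE)?)
    show "dom ?\<nu> \<subseteq> Pow (topspace (subtopology T P))"
    proof
      fix A assume "A \<in> dom ?\<nu>"
      then have "A \<subseteq> P" by (auto simp: restrict_measure_eq[OF PM] split: if_splits)
      then show "A \<in> Pow (topspace (subtopology T P))" using PX by auto
    qed
    show "{A \<in> \<MM>. A \<subseteq> P} \<subseteq> dom ?\<nu>"
    proof
      fix A assume "A \<in> {A \<in> \<MM>. A \<subseteq> P}"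
      then have "?\<nu> A = Some (m A)" using \<nu>[of A] mu_eq_Some[of A] by (simp only: mem_Collect_eq)
      then show "A \<in> dom ?\<nu>" by (rule domI)
    qed
    show "?\<nu> {} = Some 0" using \<nu> mu_empty open_sets[of "{}"] by simp
    show "0 < the (?\<nu> (topspace (subtopology T P)))"
      using PX pos PM by (simp add: inf.absorb2 \<nu>)
    show "the (?\<nu> A) \<le> the (?\<nu> B)" if "A \<in> {A \<in> \<MM>. A \<subseteq> P}" "B \<in> {A \<in> \<MM>. A \<subseteq> P}" "A \<subseteq> B" for A B
      using that by (simp add: m_mono \<nu>)
  next
    fix w :: "'l rel" and A
    assume w: "w <o cardSuc \<Lambda>" and A: "\<forall>i\<in>Field w. A i \<in> {A \<in> \<MM>. A \<subseteq> P}"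
      and disj: "disjoint_family_on A (Field w)"
    have cong: "osum w (\<lambda>i. the (?\<nu> (A i))) = osum w (\<lambda>i. m (A i))"
      using A \<nu> by (intro osum_cong) simp
    have "(\<Union>i\<in>Field w. A i) \<in> \<MM>"
      using A by (intro Union_sets ordLeq_transitive[OF card_of_image card_Field_le[OF w]]) blast
    then have "?\<nu> (\<Union>i\<in>Field w. A i) = \<mu> (\<Union>i\<in>Field w. A i)" using A by (intro \<nu>) auto
    moreover have AM: "A i \<in> \<MM>" if "i \<in> Field w" for i using A that by blast
    ultimately show "osum w (\<lambda>i. the (?\<nu> (A i))) \<noteq> None"
      "?\<nu> (\<Union>i\<in>Field w. A i) = osum w (\<lambda>i. the (?\<nu> (A i)))"
      unfolding cong using mu_UN[OF w AM disj] by simp_all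
  next
    fix x and w :: "'l rel" and A
    assume x: "x \<in> topspace (subtopology T P)" "{x} \<in> {A \<in> \<MM>. A \<subseteq> P}" and w: "w <o cardSuc \<Lambda>"
      and base: "is_open_local_base (subtopology T P) x (A ` Field w)"
    have A: "openin T (A i)" "A i \<subseteq> P" "x \<in> A i" if "i \<in> Field w" for i
      using that base by (auto simp: is_open_local_base_def opens)
    \<comment> \<open>Since \<open>P\<close> is open, a local base at \<open>x\<close> in
      \<open>P\<close> is also one in the whole space, and M5 for \<open>\<mu>\<close> becomes
      applicable.\<close>
    have "\<exists>i\<in>Field w. A i \<subseteq> U" if "openin T U" "x \<in> U" for U
    proof -
      have "openin (subtopology T P) (U \<inter> P)" "x \<in> U \<inter> P" using that P x by (auto simp: opens)
      then obtain B where "B \<in> A ` Field w" "B \<subseteq> U \<inter> P"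
        using base unfolding is_open_local_base_def by meson
      then show ?thesis by blast
    qed
    then have "is_open_local_base T x (A ` Field w)"
      unfolding is_open_local_base_def using A(1,3) by simp
    then have "\<mu> {x} = inf_opt {m (A i) |i. i \<in> Field w}"
      using x by (intro mu_point w) simp_all
    moreover have "{m (A i) |i. i \<in> Field w} = {the (?\<nu> (A i)) |i. i \<in> Field w}"
    proof -
      have "the (?\<nu> (A i)) = m (A i)" if "i \<in> Field w" for i
        using A[OF that] by (simp add: \<nu> open_sets)
      then show ?thesis unfolding Setcompr_eq_image by (intro image_cong) simp_all
    qed
    moreover have "?\<nu> {x} = \<mu> {x}" using x by (intro \<nu>) simp_all
    ultimately show "?\<nu> {x} = inf_opt {the (?\<nu> (A i)) |i. i \<in> Field w}" by (simp only:)
  qed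
  ultimately show ?thesis by (simp add: weak_measure_space_def restrict_sets_eq[OF PM])
qed

lemma continuous_measure_restrict:
  assumes "openin T P" "continuous_measure T \<MM> \<mu>"
  shows "continuous_measure (subtopology T P) (restrict_sets \<MM> P) (restrict_measure \<MM> \<mu> P)"
  using assms by (auto simp: continuous_measure_def restrict_sets_eq restrict_measure_eq open_sets)

text \<open>This is M4 for the traces of \<open>M\<close> on the pieces, along an arbitrary
  enumeration of the partition.\<close>

lemma is_set_sum_partition:
  assumes \<P>: "partition_on (topspace T) \<P>" "\<And>P. P \<in> \<P> \<Longrightarrow> openin T P" "|\<P>| \<le>o \<Lambda>"
    and "M \<in> \<MM>"
  shows "is_set_sum \<Lambda> (\<lambda>P. the (restrict_measure \<MM> \<mu> P (M \<inter> P))) \<P> (m M)"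
  unfolding is_set_sum_def
proof (intro conjI allI impI; (elim conjE)?)
  fix w :: "'l rel" and e assume w: "w <o cardSuc \<Lambda>" and e: "bij_betw e (Field w) \<P>"
  have img: "e ` Field w = \<P>" and inj: "inj_on e (Field w)" using e by (auto simp: bij_betw_def)
  have eP: "e i \<in> \<P>" if "i \<in> Field w" for i using that img by blast
  have eM: "e i \<in> \<MM>" if "i \<in> Field w" for i using eP[OF that] by (intro open_sets \<P>(2))
  have MeM: "M \<inter> e i \<in> \<MM>" if "i \<in> Field w" for i using eM[OF that] \<open>M \<in> \<MM>\<close> by (intro Int_sets)
  have "disjoint_family_on (\<lambda>i. M \<inter> e i) (Field w)"
    unfolding disjoint_family_on_def
  proof (intro ballI impI)
    fix i j assume ij: "i \<in> Field w" "j \<in> Field w" "i \<noteq> j"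
    then have "e i \<inter> e j = {}"
      using disjointD[OF partition_onD2[OF \<P>(1)] eP eP] inj_onD[OF inj] by blast
    then show "(M \<inter> e i) \<inter> (M \<inter> e j) = {}" by blast
  qed
  from mu_UN(2)[OF w MeM this]
  have "osum w (\<lambda>i. m (M \<inter> e i)) = \<mu> (\<Union>i\<in>Field w. M \<inter> e i)" by simp
  also have "(\<Union>i\<in>Field w. M \<inter> e i) = M"
    using img partition_onD1[OF \<P>(1)] sets_into_space[OF \<open>M \<in> \<MM>\<close>] by auto
  also have "osum w (\<lambda>i. m (M \<inter> e i)) =
      osum w ((\<lambda>P. the (restrict_measure \<MM> \<mu> P (M \<inter> P))) \<circ> e)"
    by (intro osum_cong) (simp add: eM MeM restrict_measure_eq)
  finally show "osum w ((\<lambda>P. the (restrict_measure \<MM> \<mu> P (M \<inter> P))) \<circ> e) = Some (m M)"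
    using mu_eq_Some[OF \<open>M \<in> \<MM>\<close>] by metis
qed (rule \<P>(3))

end

section \<open>Weak measures on a topology with a tree of cells\<close>

lemma closedin_open_partition:
  assumes "partition_on (topspace T) \<P>" "\<And>P. P \<in> \<P> \<Longrightarrow> openin T P" "P \<in> \<P>"
  shows "closedin T P"
proof -
  have "topspace T - P = \<Union>(\<P> - {P})"
    using assms(1,3) by (auto simp: partition_on_def disjoint_def)
  then show ?thesis
    using assms(2,3) openin_subset[of T P] by (auto simp: closedin_def)
qed

text \<open>\<open>cell a x\<close> stands for the cone that fixes \<open>x\<close> below level
  \<open>a\<close>. At each level the cells partition the space into open sets, and higher levels
  refine lower ones, so the argument can work with this tree instead of sequences.\<close>

locale tree_measure = weak_measure \<Lambda> T \<MM> \<mu>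
  for \<Lambda> :: "'l rel" and T :: "'x topology" and \<MM> and \<mu> :: "'x set \<rightharpoonup> 's::pos_tot_ord_monoid" +
  fixes \<kappa> :: "'k rel" and cell :: "'k \<Rightarrow> 'x \<Rightarrow> 'x set"
  assumes wo: "Well_order \<kappa>" and height: "|Field \<kappa>| \<le>o \<Lambda>" and weight: "weight T \<le>o \<Lambda>"
    and cont: "continuous_measure T \<MM> \<mu>"
    and cell_open: "x \<in> topspace T \<Longrightarrow> a \<in> Field \<kappa> \<Longrightarrow> openin T (cell a x)"
    and cell_self: "x \<in> topspace T \<Longrightarrow> x \<in> cell a x"
    and cell_eq: "y \<in> cell a x \<Longrightarrow> cell a y = cell a x"
    and cell_antimono: "(a, b) \<in> \<kappa> \<Longrightarrow> cell b x \<subseteq> cell a x"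
    and cell_base: "openin T U \<Longrightarrow> x \<in> U \<Longrightarrow> \<exists>a\<in>Field \<kappa>. cell a x \<subseteq> U"
begin

section \<open>Small cells and partitions into cells\<close>

text \<open>The cells of one level form an open partition.\<close>

lemma cell_closed:
  assumes "x \<in> topspace T" "a \<in> Field \<kappa>"
  shows "closedin T (cell a x)"
proof -
  have sub: "cell a y \<subseteq> topspace T" if "y \<in> topspace T" for y
    using cell_open[OF that assms(2)] by (rule openin_subset)
  have "partition_on (topspace T) (cell a ` topspace T)"
  proof (rule partition_onI)
    show "\<Union>(cell a ` topspace T) = topspace T" using sub cell_self by blast
    show "disjnt p q" if pq: "p \<in> cell a ` topspace T" "q \<in> cell a ` topspace T" "p \<noteq> q" for p q
    proof -
      obtain y z where "p = cell a y" "q = cell a z" using pq by blast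
      then show ?thesis using pq(3) cell_eq by (metis disjnt_iff)
    qed
    show "{} \<notin> cell a ` topspace T" using cell_self by blast
  qed
  then show ?thesis
    by (rule closedin_open_partition) (use assms cell_open in blast)+
qed

text \<open>The cells at \<open>x\<close> form a local base with at most \<open>\<Lambda>\<close>
  indices, so by M5 and continuity the infimum of their measures is \<open>0\<close>.\<close>

lemma small_cell:
  assumes x: "x \<in> topspace T" and c: "0 < c"
  shows "\<exists>a\<in>Field \<kappa>. m (cell a x) < c"
proof (rule ccontr)
  assume no: "\<not> ?thesis"
  obtain w :: "'l rel" and e where w: "w <o cardSuc \<Lambda>" and e: "bij_betw e (Field w) (Field \<kappa>)"
    using enumeration[OF height] .
  then have img: "e ` Field w = Field \<kappa>" by (simp add: bij_betw_def)
  have "is_open_local_base T x ((\<lambda>a. cell a x) ` Field \<kappa>)"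
    unfolding is_open_local_base_def using cell_open[OF x] cell_self[OF x] cell_base by simp
  then have base: "is_open_local_base T x ((\<lambda>i. cell (e i) x) ` Field w)"
    by (simp add: image_image flip: img)
  have x0: "{x} \<in> \<MM>" "\<mu> {x} = Some 0" using cont x by (auto simp: continuous_measure_def)
  have "inf_opt {m (cell (e i) x) |i. i \<in> Field w} = Some 0"
    using mu_point[OF x x0(1) w base] x0(2) by simp
  then have "isGlb UNIV {m (cell (e i) x) |i. i \<in> Field w} 0" by (rule inf_opt_SomeD)
  moreover have "isLb UNIV {m (cell (e i) x) |i. i \<in> Field w} c"
    using no img by (intro isLbI setgeI) (auto simp: not_less)
  ultimately have "c \<le> 0" by (rule isGlb_le_isLb)
  then show False using c by simp
qed

text \<open>The partition consists of the maximal cells of measure at most \<open>c\<close>.\<close>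

lemma cell_partition:
  assumes small: "\<And>x. x \<in> topspace T \<Longrightarrow> \<exists>a\<in>Field \<kappa>. m (cell a x) \<le> c"
  obtains Q where "partition_on (topspace T) Q" "|Q| \<le>o \<Lambda>"
    "\<And>C. C \<in> Q \<Longrightarrow> openin T C" "\<And>C. C \<in> Q \<Longrightarrow> m C \<le> c"
    "\<And>C x a. C \<in> Q \<Longrightarrow> x \<in> C \<Longrightarrow> a \<in> Field \<kappa> \<Longrightarrow> c < m (cell a x) \<Longrightarrow> C \<subseteq> cell a x"
proof -
  interpret wo_rel \<kappa> using wo by (simp add: wo_rel_def)
  \<comment> \<open>The least level whose cell at \<open>x\<close> has measure at most
    \<open>c\<close>. As cells shrink with the level, the least level gives the largest such
    cell.\<close>
  define f where "f x = minim {a \<in> Field \<kappa>. m (cell a x) \<le> c}" for x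
  have f: "f x \<in> Field \<kappa>" "m (cell (f x) x) \<le> c" if "x \<in> topspace T" for x
    using minim_in[of "{a \<in> Field \<kappa>. m (cell a x) \<le> c}"] small[OF that] by (auto simp: f_def)
  have f_least: "(f x, a) \<in> \<kappa>" if "a \<in> Field \<kappa>" "m (cell a x) \<le> c" for x a
    using that by (auto simp: f_def intro: minim_least)
  \<comment> \<open>The cell of \<open>x\<close> also witnesses smallness for \<open>y\<close>, so
    \<open>f y\<close> is at most \<open>f x\<close>. Then \<open>x\<close> lies in the cell of
    \<open>y\<close>, which gives the converse comparison.\<close>
  have f_cell: "cell (f y) y = cell (f x) x" if x: "x \<in> topspace T" and y: "y \<in> cell (f x) x" for x y
  proof -
    have yX: "y \<in> topspace T" using openin_subset[OF cell_open[OF x f(1)[OF x]]] y by blast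
    have eq: "cell (f x) y = cell (f x) x" using y by (rule cell_eq)
    have le: "(f y, f x) \<in> \<kappa>" using f[OF x] eq by (intro f_least) auto
    have "x \<in> cell (f y) y" using cell_antimono[OF le, of y] eq cell_self[OF x, of "f x"] by blast
    then have "cell (f y) x = cell (f y) y" by (rule cell_eq)
    then have "(f x, f y) \<in> \<kappa>" using f[OF yX] by (intro f_least) auto
    with le have "f x = f y" using ANTISYM by (auto dest: antisymD)
    then show ?thesis using eq by simp
  qed
  define Q where "Q = (\<lambda>x. cell (f x) x) ` topspace T"
  have Q_eq: "C = cell (f x) x" "x \<in> topspace T" if C: "C \<in> Q" "x \<in> C" for C x
  proof -
    obtain y where y: "y \<in> topspace T" "C = cell (f y) y" using C(1) by (auto simp: Q_def)
    then show "x \<in> topspace T" using C(2) openin_subset[OF cell_open[OF y(1) f(1)[OF y(1)]]] by blast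
    show "C = cell (f x) x" using f_cell y C(2) by simp
  qed
  have Q_open: "openin T C" if "C \<in> Q" for C using that f cell_open by (auto simp: Q_def)
  have Q_ne: "{} \<notin> Q" using cell_self by (auto simp: Q_def)
  have part: "partition_on (topspace T) Q"
  proof (rule partition_onI)
    show "\<Union>Q = topspace T"
    proof
      show "\<Union>Q \<subseteq> topspace T" using Q_eq(2) by blast
      show "topspace T \<subseteq> \<Union>Q" using cell_self by (auto simp: Q_def)
    qed
    show "disjnt C D" if "C \<in> Q" "D \<in> Q" "C \<noteq> D" for C D
      using Q_eq(1) that by (metis disjnt_iff)
  qed (rule Q_ne)
  \<comment> \<open>The pieces are nonempty, open and disjoint, so the weight bounds their
    number.\<close>
  have card: "|Q| \<le>o \<Lambda>"
    using card_disjoint_open_le_weight[OF Q_open partition_onD2[OF part] Q_ne] weight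
      ordLeq_transitive by blast
  have "m C \<le> c" if "C \<in> Q" for C using that f by (auto simp: Q_def)
  moreover have "C \<subseteq> cell a x" if C: "C \<in> Q" "x \<in> C" and a: "a \<in> Field \<kappa>" "c < m (cell a x)" for C x a
  proof -
    note Ceq = Q_eq[OF C]
    \<comment> \<open>Otherwise \<open>cell a x\<close> would lie inside a cell of measure at most
      \<open>c\<close>.\<close>
    have "(f x, a) \<notin> \<kappa>"
    proof
      assume "(f x, a) \<in> \<kappa>"
      then have "m (cell a x) \<le> m (cell (f x) x)"
        using Ceq(2) a f(1) by (intro m_mono open_sets cell_open cell_antimono) auto
      then show False using f(2)[OF Ceq(2)] a(2) by simp
    qed
    then have "(a, f x) \<in> \<kappa>" using TOTALS a f(1)[OF Ceq(2)] by blast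
    then show ?thesis using Ceq(1) cell_antimono by blast
  qed
  ultimately show ?thesis using that[OF part card Q_open] by blast
qed

section \<open>Archimedean threshold and countable coinitiality\<close>

text \<open>If every point had a null cell, \<open>cell_partition\<close> with \<open>c = 0\<close>
  would split the space into at most \<open>\<Lambda>\<close> null pieces, contradicting M2.\<close>

lemma support_point:
  obtains x where "x \<in> topspace T" "\<And>a. a \<in> Field \<kappa> \<Longrightarrow> 0 < m (cell a x)"
proof -
  have "\<exists>x\<in>topspace T. \<forall>a\<in>Field \<kappa>. 0 < m (cell a x)"
  proof (rule ccontr)
    assume "\<not> ?thesis"
    then have "\<exists>a\<in>Field \<kappa>. m (cell a x) \<le> 0" if "x \<in> topspace T" for x
      using that by (meson not_less)
    then obtain Q where Q: "partition_on (topspace T) Q" "|Q| \<le>o \<Lambda>"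
      "\<And>C. C \<in> Q \<Longrightarrow> openin T C" "\<And>C. C \<in> Q \<Longrightarrow> m C \<le> 0"
      using cell_partition by metis
    have "m (\<Union>Q) = 0"
    proof (rule m_Union_null[OF _ partition_onD2[OF Q(1)] Q(2)])
      show "Q \<subseteq> \<MM>" using Q(3) open_sets by blast
      show "m C = 0" if "C \<in> Q" for C using Q(4)[OF that] zero_least by (rule order_antisym)
    qed
    then show False using m_space_pos partition_onD1[OF Q(1)] by simp
  qed
  then show ?thesis using that by blast
qed

text \<open>
  If there were no such \<open>\<epsilon>\<close>, every positive element would be infinite relative to some smaller
  positive element. Choosing \<open>0 < b < \<mu>(X)\<close> and \<open>d\<close> infinitesimal relative to \<open>b\<close>, the partition of \<open>X\<close> into cells of measure
  at most \<open>d\<close> would give \<open>\<mu>(X) \<le> b\<close>.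
\<close>

lemma archimedean_bound:
  obtains \<epsilon> :: 's where "0 < \<epsilon>" "\<And>d. 0 < d \<Longrightarrow> \<exists>n. \<epsilon> < sum_list (replicate n d)"
proof -
  have "\<exists>\<epsilon>::'s. 0 < \<epsilon> \<and> (\<forall>d>0. \<exists>n. \<epsilon> < sum_list (replicate n d))"
  proof (rule ccontr)
    assume no: "\<not> ?thesis"
    obtain x where x: "x \<in> topspace T" "\<And>a. a \<in> Field \<kappa> \<Longrightarrow> 0 < m (cell a x)"
      using support_point by blast
    \<comment> \<open>The measure of this cell is the element \<open>b\<close>: positive by the
      choice of \<open>x\<close>, and below the total measure by \<open>small_cell\<close>.\<close>
    obtain a where a: "a \<in> Field \<kappa>" "m (cell a x) < m (topspace T)"
      using small_cell[OF x(1) m_space_pos] by blast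
    \<comment> \<open>The assumed failure is applied to \<open>m (cell a x)\<close> in the role of
      \<open>\<epsilon>\<close>.\<close>
    obtain d :: 's where d: "0 < d" "\<And>n. sum_list (replicate n d) \<le> m (cell a x)"
      using no x(2)[OF a(1)] by (meson not_less)
    have "\<exists>a\<in>Field \<kappa>. m (cell a y) \<le> d" if "y \<in> topspace T" for y
      using small_cell[OF that d(1)] less_imp_le by blast
    then obtain Q where Q: "partition_on (topspace T) Q" "|Q| \<le>o \<Lambda>"
      "\<And>C. C \<in> Q \<Longrightarrow> openin T C" "\<And>C. C \<in> Q \<Longrightarrow> m C \<le> d"
      using cell_partition by metis
    have "Q \<subseteq> \<MM>" using Q(3) open_sets by blast
    then have "m (\<Union>Q) \<le> m (cell a x)"
      using m_Union_le_replicate[OF _ partition_onD2[OF Q(1)] Q(2) Q(4) d(2)] by blast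
    then show False using a(2) partition_onD1[OF Q(1)] by simp
  qed
  then show ?thesis using that by blast
qed

text \<open>
  The differences of successive cells around a point of the support form an infinite disjoint
  family, whose measures cannot be bounded away from zero.
\<close>

lemma countable_coinitial:
  fixes \<epsilon> :: 's
  assumes "0 < \<epsilon>" and arch: "\<And>d. 0 < d \<Longrightarrow> \<exists>n. \<epsilon> < sum_list (replicate n d)"
  obtains S :: "'s set" where "countable S" "\<And>s. s \<in> S \<Longrightarrow> 0 < s" "\<And>c. 0 < c \<Longrightarrow> \<exists>s\<in>S. s < c"
proof -
  interpret wo_rel \<kappa> using wo by (simp add: wo_rel_def)
  obtain x where x: "x \<in> topspace T" "\<And>a. a \<in> Field \<kappa> \<Longrightarrow> 0 < m (cell a x)"
    using support_point by blast
  \<comment> \<open>Every cell at \<open>x\<close> has positive measure, so this measure can itself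
    be the bound in \<open>small_cell\<close>, which yields the next, strictly smaller cell.\<close>
  have "\<exists>a. \<forall>n. (a n \<in> Field \<kappa> \<and> m (cell (a n) x) < \<epsilon>) \<and> m (cell (a (Suc n)) x) < m (cell (a n) x)"
  proof (rule dependent_nat_choice)
    show "\<exists>a. a \<in> Field \<kappa> \<and> m (cell a x) < \<epsilon>" using small_cell[OF x(1) \<open>0 < \<epsilon>\<close>] by blast
    show "\<exists>b. (b \<in> Field \<kappa> \<and> m (cell b x) < \<epsilon>) \<and> m (cell b x) < m (cell a x)"
      if "a \<in> Field \<kappa> \<and> m (cell a x) < \<epsilon>" for a
      using small_cell[OF x(1) x(2)[of a]] that by (meson less_trans)
  qed
  then obtain a where a: "\<And>n. a n \<in> Field \<kappa>" "\<And>n. m (cell (a n) x) < \<epsilon>"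
    "\<And>n. m (cell (a (Suc n)) x) < m (cell (a n) x)" by blast
  define U where "U n = cell (a n) x" for n
  have U_open: "openin T (U n)" and U_closed: "closedin T (U n)" for n
    using cell_open[OF x(1) a(1)] cell_closed[OF x(1) a(1)] by (auto simp: U_def)
  have U_sets: "U n \<in> \<MM>" for n using U_open open_sets by blast
  have U_Suc: "U (Suc n) \<subseteq> U n" for n
  proof -
    \<comment> \<open>The reverse order of levels would contradict the strict decrease of the
      measures.\<close>
    have "(a (Suc n), a n) \<notin> \<kappa>"
    proof
      assume "(a (Suc n), a n) \<in> \<kappa>"
      then have "m (U n) \<le> m (U (Suc n))"
        unfolding U_def using U_sets[unfolded U_def] by (intro m_mono cell_antimono)
      then show False using a(3)[of n] by (simp add: U_def)
    qed
    then have "(a n, a (Suc n)) \<in> \<kappa>" using TOTALS a(1) by blast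
    then show ?thesis unfolding U_def by (rule cell_antimono)
  qed
  have U_anti: "U j \<subseteq> U i" if "i \<le> j" for i j
    using lift_Suc_antimono_le[of U, OF U_Suc that] .
  define D where "D n = U n - U (Suc n)" for n
  have D_sets: "D n \<in> \<MM>" for n unfolding D_def by (intro open_sets openin_diff U_open U_closed)
  \<comment> \<open>A null difference could be absorbed by \<open>m_Un_null\<close>, making two
    successive measures equal.\<close>
  have D_pos: "0 < m (D n)" for n
  proof (rule ccontr)
    assume "\<not> 0 < m (D n)"
    then have "m (D n) = 0" using zero_least[of "m (D n)"] by simp
    then have "m (U (Suc n) \<union> D n) = m (U (Suc n))"
      by (intro m_Un_null U_sets D_sets) (auto simp: D_def)
    moreover have "U (Suc n) \<union> D n = U n" using U_Suc by (auto simp: D_def)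
    ultimately show False using a(3)[of n] by (simp add: U_def)
  qed
  have D_disj: "D i \<inter> D j = {}" if "i < j" for i j
    using U_anti[of "Suc i" j] that by (auto simp: D_def)
  have D_ne: "D i \<noteq> {}" for i using D_pos[of i] mu_empty by auto
  have D_eq: "i = j" if "D i = D j" for i j
    using D_disj[of i j] D_disj[of j i] D_ne[of i] that by (cases i j rule: linorder_cases) auto
  \<comment> \<open>Otherwise \<open>finite_disjoint_above\<close>, applied inside
    \<open>U 0\<close>, would make the range of the injective sequence \<open>D\<close>
    finite.\<close>
  have "\<exists>s\<in>range (\<lambda>n. m (D n)). s < c" if c: "0 < c" for c
  proof (rule ccontr)
    assume no: "\<not> ?thesis"
    obtain n where n: "\<epsilon> < sum_list (replicate n c)" using arch[OF c] by blast
    have "finite (range D)"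
    proof (rule finite_disjoint_above)
      show "range D \<subseteq> \<MM>" using D_sets by blast
      show "disjoint (range D)"
        unfolding disjoint_def using D_disj by (metis Int_commute linorder_neqE_nat rangeE)
      show "c \<le> m A" if "A \<in> range D" for A using no that by (auto simp: not_less)
      show "U 0 \<in> \<MM>" by (rule U_sets)
      show "\<Union>(range D) \<subseteq> U 0" using U_anti[of 0] by (auto simp: D_def)
      show "m (U 0) < sum_list (replicate n c)" using a(2)[of 0] n by (simp add: U_def)
    qed
    then show False using range_inj_infinite[of D] D_eq by (auto simp: inj_def)
  qed
  then show ?thesis using D_pos by (intro that[of "range (\<lambda>n. m (D n))"]) auto
qed

text \<open>For each threshold in a countable coinitial set there is a partition into small cells.
  The traces on the support of all their positive pieces inside \<open>P\<close> form a countable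
  base of the support.\<close>

lemma Dirac_restrict:
  fixes \<epsilon> :: 's
  assumes "0 < \<epsilon>" and arch: "\<And>d. 0 < d \<Longrightarrow> \<exists>n. \<epsilon> < sum_list (replicate n d)"
    and P: "openin T P" "m P \<le> \<epsilon>"
  shows "Dirac_measure (cardSuc natLeq) (subtopology T P) (restrict_measure \<MM> \<mu> P)"
proof -
  obtain S :: "'s set" where S: "countable S" "\<And>s. s \<in> S \<Longrightarrow> 0 < s" "\<And>c. 0 < c \<Longrightarrow> \<exists>s\<in>S. s < c"
    using countable_coinitial[OF assms(1,2)] by blast
  \<comment> \<open>The last clause is the one that yields a base: a piece lies inside every cell of
    measure above \<open>s\<close> around each of its points.\<close>
  define sep_part where "sep_part s \<Q> \<longleftrightarrow> partition_on (topspace T) \<Q> \<and> (\<forall>C\<in>\<Q>. openin T C) \<and>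
      (\<forall>C\<in>\<Q>. \<forall>x\<in>C. \<forall>a\<in>Field \<kappa>. s < m (cell a x) \<longrightarrow> C \<subseteq> cell a x)" for s \<Q>
  have "\<exists>\<Q>. sep_part s \<Q>" if s: "s \<in> S" for s
  proof -
    have "\<exists>a\<in>Field \<kappa>. m (cell a x) \<le> s" if "x \<in> topspace T" for x
      using small_cell[OF that S(2)[OF s]] less_imp_le by blast
    then show ?thesis
    proof (rule cell_partition)
      fix \<Q> assume "partition_on (topspace T) \<Q>" "\<And>C. C \<in> \<Q> \<Longrightarrow> openin T C"
        "\<And>C x a. C \<in> \<Q> \<Longrightarrow> x \<in> C \<Longrightarrow> a \<in> Field \<kappa> \<Longrightarrow> s < m (cell a x) \<Longrightarrow> C \<subseteq> cell a x"
      then show ?thesis unfolding sep_part_def by (intro exI[of _ \<Q>]) simp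
    qed
  qed
  then obtain Q where "\<And>s. s \<in> S \<Longrightarrow> sep_part s (Q s)" by metis
  then have Q: "\<And>s. s \<in> S \<Longrightarrow> partition_on (topspace T) (Q s)"
    "\<And>s C. s \<in> S \<Longrightarrow> C \<in> Q s \<Longrightarrow> openin T C"
    "\<And>s C x a. s \<in> S \<Longrightarrow> C \<in> Q s \<Longrightarrow> x \<in> C \<Longrightarrow> a \<in> Field \<kappa> \<Longrightarrow> s < m (cell a x) \<Longrightarrow> C \<subseteq> cell a x"
    unfolding sep_part_def by simp_all
  define \<C> where "\<C> = {C. \<exists>s\<in>S. C \<in> Q s \<and> C \<subseteq> P \<and> 0 < m C}"
  have PM: "P \<in> \<MM>" using P(1) by (rule open_sets)
  \<comment> \<open>Some multiple of \<open>t\<close> exceeds \<open>\<epsilon>\<close>, hence also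
    \<open>m P\<close>, so only finitely many disjoint pieces inside \<open>P\<close> have measure
    at least \<open>t\<close>.\<close>
  have "countable {C \<in> Q s. C \<subseteq> P \<and> t \<le> m C}" if "s \<in> S" "t \<in> S" for s t
  proof (rule countable_finite)
    obtain n where n: "\<epsilon> < sum_list (replicate n t)" using arch[OF S(2)[OF \<open>t \<in> S\<close>]] by blast
    show "finite {C \<in> Q s. C \<subseteq> P \<and> t \<le> m C}"
    proof (rule finite_disjoint_above)
      show "{C \<in> Q s. C \<subseteq> P \<and> t \<le> m C} \<subseteq> \<MM>" using Q(2)[OF \<open>s \<in> S\<close>] open_sets by blast
      show "disjoint {C \<in> Q s. C \<subseteq> P \<and> t \<le> m C}"
        using partition_onD2[OF Q(1)[OF \<open>s \<in> S\<close>]] by (rule pairwise_subset) blast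
      show "m P < sum_list (replicate n t)" using P(2) n by simp
    qed (use PM in auto)
  qed
  then have "countable (\<Union>s\<in>S. \<Union>t\<in>S. {C \<in> Q s. C \<subseteq> P \<and> t \<le> m C})"
    using S(1) by (intro countable_UN)
  \<comment> \<open>Coinitiality of \<open>S\<close> puts some \<open>t\<close> below any positive
    measure.\<close>
  moreover have "\<C> \<subseteq> (\<Union>s\<in>S. \<Union>t\<in>S. {C \<in> Q s. C \<subseteq> P \<and> t \<le> m C})"
  proof
    fix C assume "C \<in> \<C>"
    then obtain s where s: "s \<in> S" "C \<in> Q s" "C \<subseteq> P" "0 < m C" by (auto simp: \<C>_def)
    obtain t where "t \<in> S" "t < m C" using S(3)[OF s(4)] by blast
    then have "t \<in> S" "t \<le> m C" by simp_all
    then show "C \<in> (\<Union>s\<in>S. \<Union>t\<in>S. {C \<in> Q s. C \<subseteq> P \<and> t \<le> m C})" using s by blast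
  qed
  ultimately have "countable \<C>" by (rule countable_subset[rotated])
  define Z where "Z = measure_supp (subtopology T P) (restrict_measure \<MM> \<mu> P)"
  have "Z \<subseteq> P" by (auto simp: Z_def measure_supp_def)
  then have sub: "subtopology (subtopology T P) Z = subtopology T Z"
    by (simp add: subtopology_subtopology inf.absorb2)
  \<comment> \<open>A null open subset of \<open>P\<close> is also null for the restricted measure
    and therefore misses the support.\<close>
  have supp_pos: "0 < m U" if U: "openin T U" "U \<subseteq> P" "x \<in> U" "x \<in> Z" for U x
  proof (rule ccontr)
    assume "\<not> 0 < m U"
    then have "m U = 0" using zero_least[of "m U"] by simp
    then have "\<mu> U = Some 0" using mu_eq_Some[OF open_sets[OF U(1)]] by simp
    then have "restrict_measure \<MM> \<mu> P U = Some 0"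
      using open_sets[OF U(1)] U(2) by (simp add: restrict_measure_eq[OF PM])
    moreover have "openin (subtopology T P) U" using U P(1) openin_open_subtopology by blast
    ultimately show False using U(3,4) by (auto simp: Z_def measure_supp_def)
  qed
  let ?B = "(\<lambda>C. C \<inter> Z) ` \<C>"
  have "is_base (subtopology T Z) ?B"
  proof (rule is_baseI)
    show "openin (subtopology T Z) B" if "B \<in> ?B" for B
      using that Q(2) by (auto simp: \<C>_def intro: openin_subtopology_Int)
    fix U x assume U: "openin (subtopology T Z) U" "x \<in> U"
    then obtain W where W: "openin T W" "U = W \<inter> Z" by (auto simp: openin_subtopology)
    have "openin T (W \<inter> P)" "x \<in> W \<inter> P" using W P(1) U(2) \<open>Z \<subseteq> P\<close> by auto
    then obtain a where a: "a \<in> Field \<kappa>" "cell a x \<subseteq> W \<inter> P" using cell_base by blast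
    have xT: "x \<in> topspace T" using openin_subset[OF W(1)] W(2) U(2) by blast
    \<comment> \<open>The cell contains the support point \<open>x\<close>, so a threshold
      \<open>s\<close> lies below its measure, and the piece of \<open>Q s\<close> at
      \<open>x\<close> must fit inside the cell.\<close>
    have "0 < m (cell a x)"
      using a cell_open[OF xT] cell_self[OF xT] U(2) W(2) by (intro supp_pos) auto
    then obtain s where s: "s \<in> S" "s < m (cell a x)" using S(3) by blast
    obtain C where C: "C \<in> Q s" "x \<in> C" using xT partition_onD1[OF Q(1)[OF s(1)]] by blast
    have "C \<subseteq> cell a x" using Q(3)[OF s(1) C a(1) s(2)] .
    then have CW: "C \<subseteq> W" "C \<subseteq> P" using a(2) by auto
    \<comment> \<open>The piece contains \<open>x\<close> as well, so it is positive and belongs to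
      the countable family.\<close>
    then have "0 < m C" using Q(2)[OF s(1) C(1)] C(2) U(2) W(2) by (intro supp_pos) auto
    then have "C \<in> \<C>" using s(1) C(1) CW(2) by (auto simp: \<C>_def)
    then show "\<exists>B\<in>?B. x \<in> B \<and> B \<subseteq> U" using C(2) CW(1) U(2) W(2) by auto
  qed
  then have "weight (subtopology T Z) \<le>o |?B|" using weight_minimal_base by metis
  moreover have "|?B| \<le>o natLeq"
  proof -
    obtain g :: "'x set \<Rightarrow> nat" where "inj_on g ?B"
      using \<open>countable \<C>\<close> countableE[OF countable_image] by blast
    then have "|?B| \<le>o |UNIV :: nat set|" by (intro card_of_ordLeqI) auto
    then show ?thesis using card_of_nat ordLeq_ordIso_trans by blast
  qed
  ultimately have "weight (subtopology T Z) \<le>o natLeq" by (rule ordLeq_transitive)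
  then have "weight (subtopology T Z) <o cardSuc natLeq"
    using cardSuc_greater[OF natLeq_Card_order] ordLeq_ordLess_trans by blast
  then show ?thesis by (simp add: Dirac_measure_def sub flip: Z_def)
qed

text \<open>\<open>archimedean_bound\<close> supplies the threshold and
  \<open>cell_partition\<close> the pieces. Null pieces would violate M2, which is why the partition
  is modified before restricting.\<close>

theorem Dirac_partition:
  "\<exists>\<P>. partition_on (topspace T) \<P> \<and> (\<forall>P\<in>\<P>. openin T P \<and> closedin T P) \<and>
     (\<forall>P\<in>\<P>.
        weak_measure_space \<Lambda> (subtopology T P) (restrict_sets \<MM> P) (restrict_measure \<MM> \<mu> P) \<and>
        continuous_measure (subtopology T P) (restrict_sets \<MM> P) (restrict_measure \<MM> \<mu> P) \<and>
        Dirac_measure (cardSuc natLeq) (subtopology T P) (restrict_measure \<MM> \<mu> P)) \<and>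
     (\<forall>M\<in>\<MM>. is_set_sum \<Lambda> (\<lambda>P. the (restrict_measure \<MM> \<mu> P (M \<inter> P))) \<P> (m M))"
proof -
  obtain \<epsilon> :: 's where \<epsilon>: "0 < \<epsilon>" "\<And>d. 0 < d \<Longrightarrow> \<exists>n. \<epsilon> < sum_list (replicate n d)"
    using archimedean_bound by blast
  have "\<exists>a\<in>Field \<kappa>. m (cell a x) \<le> \<epsilon>" if "x \<in> topspace T" for x
    using small_cell[OF that \<epsilon>(1)] less_imp_le by blast
  then obtain Q where Q: "partition_on (topspace T) Q" "|Q| \<le>o \<Lambda>"
    "\<And>C. C \<in> Q \<Longrightarrow> openin T C" "\<And>C. C \<in> Q \<Longrightarrow> m C \<le> \<epsilon>"
    using cell_partition by metis
  have QM: "Q \<subseteq> \<MM>" using Q(3) open_sets by blast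
  have null_iff: "m C = 0 \<longleftrightarrow> \<not> 0 < m C" for C
    using zero_least[of "m C"] by auto
  define \<N> where "\<N> = {C \<in> Q. m C = 0}"
  have \<N>: "\<N> \<subseteq> Q" by (auto simp: \<N>_def)
  have N_card: "|\<N>| \<le>o \<Lambda>" using card_of_mono1[OF \<N>] Q(2) ordLeq_transitive by blast
  have N_open: "openin T (\<Union>\<N>)" using \<N> Q(3) by blast
  have N_null: "m (\<Union>\<N>) = 0"
    by (rule m_Union_null[OF _ pairwise_subset[OF partition_onD2[OF Q(1)] \<N>] N_card])
      (use QM in \<open>auto simp: \<N>_def\<close>)
  have "\<Union>\<N> \<noteq> topspace T" using N_null m_space_pos by auto
  \<comment> \<open>The null pieces cannot cover the space, as their union is null.\<close>
  then obtain P\<^sub>0 where P\<^sub>0: "P\<^sub>0 \<in> Q" "P\<^sub>0 \<notin> \<N>" using \<N> partition_onD1[OF Q(1)] by blast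
  have disj: "C \<inter> D = {}" if "C \<in> Q" "D \<in> Q" "C \<noteq> D" for C D
    using disjointD[OF partition_onD2[OF Q(1)] that] .
  then have P\<^sub>0_N: "P\<^sub>0 \<inter> \<Union>\<N> = {}" using P\<^sub>0 \<N> by blast
  \<comment> \<open>Absorbing a null set leaves the measure unchanged, so the merged piece stays
    positive and bounded by \<open>\<epsilon>\<close>.\<close>
  have m_P\<^sub>0: "m (P\<^sub>0 \<union> \<Union>\<N>) = m P\<^sub>0"
    using QM P\<^sub>0(1) open_sets[OF N_open] P\<^sub>0_N N_null by (intro m_Un_null) auto
  define \<P> where "\<P> = insert (P\<^sub>0 \<union> \<Union>\<N>) (Q - \<N> - {P\<^sub>0})"
  have \<P>_cases: "P \<in> \<P> \<Longrightarrow> P = P\<^sub>0 \<union> \<Union>\<N> \<or> P \<in> Q \<and> P \<notin> \<N> \<and> P \<noteq> P\<^sub>0" for P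
    by (auto simp: \<P>_def)
  have open_P: "openin T P" if "P \<in> \<P>" for P
    using \<P>_cases[OF that] Q(3) P\<^sub>0(1) N_open by auto
  have m_P: "0 < m P" "m P \<le> \<epsilon>" if "P \<in> \<P>" for P
    using \<P>_cases[OF that] Q(4) P\<^sub>0 m_P\<^sub>0 null_iff by (auto simp: \<N>_def)
  have part: "partition_on (topspace T) \<P>"
  proof (rule partition_onI)
    have "\<Union>\<P> = \<Union>Q" using \<N> P\<^sub>0(1) by (auto simp: \<P>_def)
    then show "\<Union>\<P> = topspace T" using partition_onD1[OF Q(1)] by simp
    have *: "(P\<^sub>0 \<union> \<Union>\<N>) \<inter> C = {}" if "C \<in> Q" "C \<notin> \<N>" "C \<noteq> P\<^sub>0" for C
    proof -
      have "P\<^sub>0 \<inter> C = {}" using disj that P\<^sub>0(1) by blast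
      moreover have "D \<inter> C = {}" if "D \<in> \<N>" for D
        using disj[of D C] that \<open>C \<in> Q\<close> \<open>C \<notin> \<N>\<close> \<N> by blast
      ultimately show ?thesis by blast
    qed
    show "disjnt p q" if "p \<in> \<P>" "q \<in> \<P>" "p \<noteq> q" for p q
      using \<P>_cases[OF that(1)] \<P>_cases[OF that(2)] that(3) *[of p] *[of q] disj[of p q]
      by (auto simp: disjnt_def Int_commute)
    show "{} \<notin> \<P>" using m_P(1)[of "{}"] mu_empty by auto
  qed
  have card: "|\<P>| \<le>o \<Lambda>"
    using card_disjoint_open_le_weight[OF open_P partition_onD2[OF part] partition_onD3[OF part]]
      weight ordLeq_transitive by blast
  show ?thesis
  proof (intro exI[of _ \<P>] conjI ballI)
    show "partition_on (topspace T) \<P>" by (rule part)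
    show "openin T P" if "P \<in> \<P>" for P using that by (rule open_P)
    show "closedin T P" if "P \<in> \<P>" for P using part open_P that by (rule closedin_open_partition)
    show "weak_measure_space \<Lambda> (subtopology T P) (restrict_sets \<MM> P) (restrict_measure \<MM> \<mu> P)"
      if "P \<in> \<P>" for P using open_P[OF that] m_P(1)[OF that] by (rule weak_measure_space_restrict)
    show "continuous_measure (subtopology T P) (restrict_sets \<MM> P) (restrict_measure \<MM> \<mu> P)"
      if "P \<in> \<P>" for P using open_P[OF that] cont by (rule continuous_measure_restrict)
    show "Dirac_measure (cardSuc natLeq) (subtopology T P) (restrict_measure \<MM> \<mu> P)"
      if "P \<in> \<P>" for P using \<epsilon> open_P[OF that] m_P(2)[OF that] by (rule Dirac_restrict)
    show "is_set_sum \<Lambda> (\<lambda>P. the (restrict_measure \<MM> \<mu> P (M \<inter> P))) \<P> (m M)" if "M \<in> \<MM>" for M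
      using part open_P card that by (rule is_set_sum_partition)
  qed
qed

end

section \<open>The bounded topology\<close>

lemma mem_seq_cone_self: "x \<in> seqs \<kappa> \<Lambda> \<Longrightarrow> x \<in> seq_cone \<kappa> \<Lambda> a x"
  by (simp add: seq_cone_def)

lemma seq_cone_eq: "y \<in> seq_cone \<kappa> \<Lambda> a s \<Longrightarrow> seq_cone \<kappa> \<Lambda> a y = seq_cone \<kappa> \<Lambda> a s"
  by (auto simp: seq_cone_def)

lemma seq_cone_antimono:
  assumes "Well_order \<kappa>" "(a, b) \<in> \<kappa>"
  shows "seq_cone \<kappa> \<Lambda> b s \<subseteq> seq_cone \<kappa> \<Lambda> a s"
proof -
  have "trans \<kappa>" "antisym \<kappa>"
    using assms(1) by (auto simp: well_order_on_def linear_order_on_def partial_order_on_def preorder_on_def)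
  then have "underS \<kappa> a \<subseteq> underS \<kappa> b" using assms(2) by (rule underS_incr)
  then show ?thesis by (auto simp: seq_cone_def)
qed

text \<open>The generators are cones of sequences defined only below \<open>a\<close>, so
  \<open>x\<close> is replaced by its restriction.\<close>

lemma openin_seq_cone:
  assumes "a \<in> Field \<kappa>" "x \<in> seqs \<kappa> \<Lambda>"
  shows "openin (bounded_topology \<kappa> \<Lambda>) (seq_cone \<kappa> \<Lambda> a x)"
proof -
  have "underS \<kappa> a \<subseteq> Field \<kappa>" by (auto simp: underS_def Field_def)
  then have "restrict x (underS \<kappa> a) \<in> underS \<kappa> a \<rightarrow>\<^sub>E Field \<Lambda>" using assms(2) by (auto simp: seqs_def)
  moreover have "seq_cone \<kappa> \<Lambda> a x = seq_cone \<kappa> \<Lambda> a (restrict x (underS \<kappa> a))"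
    by (simp add: seq_cone_def)
  ultimately show ?thesis
    unfolding bounded_topology_def using assms(1) by (intro topology_generated_by_Basis) blast
qed

lemma topspace_bounded_topology:
  assumes "Field \<kappa> \<noteq> {}"
  shows "topspace (bounded_topology \<kappa> \<Lambda>) = seqs \<kappa> \<Lambda>"
proof
  show "topspace (bounded_topology \<kappa> \<Lambda>) \<subseteq> seqs \<kappa> \<Lambda>"
    unfolding bounded_topology_def topology_generated_by_topspace by (auto simp: seq_cone_def)
  show "seqs \<kappa> \<Lambda> \<subseteq> topspace (bounded_topology \<kappa> \<Lambda>)"
  proof
    fix x assume x: "x \<in> seqs \<kappa> \<Lambda>"
    obtain a where "a \<in> Field \<kappa>" using assms by blast
    then show "x \<in> topspace (bounded_topology \<kappa> \<Lambda>)"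
      using openin_subset[OF openin_seq_cone[OF _ x]] mem_seq_cone_self[OF x] by blast
  qed
qed

text \<open>Induction on the generation of open sets. Cones at one point are nested, so for an
  intersection the one of higher level serves.\<close>

lemma bounded_topology_nbhd:
  assumes wo: "Well_order \<kappa>" and ne: "Field \<kappa> \<noteq> {}"
    and "openin (bounded_topology \<kappa> \<Lambda>) U" "x \<in> U"
  shows "\<exists>a\<in>Field \<kappa>. seq_cone \<kappa> \<Lambda> a x \<subseteq> U"
proof -
  have "generate_topology_on
      {seq_cone \<kappa> \<Lambda> a s |a s. a \<in> Field \<kappa> \<and> s \<in> underS \<kappa> a \<rightarrow>\<^sub>E Field \<Lambda>} U"
    using assms(3) unfolding bounded_topology_def by (rule openin_topology_generated_by)
  then have "\<forall>x\<in>U. \<exists>a\<in>Field \<kappa>. seq_cone \<kappa> \<Lambda> a x \<subseteq> U"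
  proof induction
    case (Int U V)
    show ?case
    proof
      fix x assume "x \<in> U \<inter> V"
      then obtain a b where ab: "a \<in> Field \<kappa>" "b \<in> Field \<kappa>"
        "seq_cone \<kappa> \<Lambda> a x \<subseteq> U" "seq_cone \<kappa> \<Lambda> b x \<subseteq> V" using Int.IH by blast
      then have "(a, b) \<in> \<kappa> \<or> (b, a) \<in> \<kappa>"
        using wo_rel.TOTALS[of \<kappa>] wo by (auto simp: wo_rel_def)
      then show "\<exists>c\<in>Field \<kappa>. seq_cone \<kappa> \<Lambda> c x \<subseteq> U \<inter> V"
      proof
        assume "(a, b) \<in> \<kappa>"
        from seq_cone_antimono[OF wo this, of \<Lambda> x] show ?thesis using ab by blast
      next
        assume "(b, a) \<in> \<kappa>"
        from seq_cone_antimono[OF wo this, of \<Lambda> x] show ?thesis using ab by blast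
      qed
    qed
  next
    case (UN K)
    show ?case
    proof
      fix x assume "x \<in> \<Union>K"
      then obtain V where "V \<in> K" "x \<in> V" by blast
      then show "\<exists>a\<in>Field \<kappa>. seq_cone \<kappa> \<Lambda> a x \<subseteq> \<Union>K" using UN.IH[of V] by blast
    qed
  next
    case (Basis V)
    then obtain a s where V: "V = seq_cone \<kappa> \<Lambda> a s" "a \<in> Field \<kappa>" by blast
    show ?case
    proof
      fix x assume "x \<in> V"
      \<comment> \<open>Each point of a cone determines the same cone at that level.\<close>
      then have "seq_cone \<kappa> \<Lambda> a x = V" unfolding V(1) by (rule seq_cone_eq)
      then show "\<exists>a\<in>Field \<kappa>. seq_cone \<kappa> \<Lambda> a x \<subseteq> V" using V(2) by blast
    qed
  qed simp
  then show ?thesis using assms(4) by blast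
qed

theorem proposition6p10:
  fixes \<kappa> :: "'k rel" and \<Lambda> :: "'l rel"
    and X :: "('k \<Rightarrow> 'l) set"
    and \<MM> :: "('k \<Rightarrow> 'l) set set"
    and \<mu> :: "('k \<Rightarrow> 'l) set \<rightharpoonup> 's::pos_tot_ord_monoid"
  defines "T \<equiv> subtopology (bounded_topology \<kappa> \<Lambda>) X"
  assumes "Card_order \<kappa>" and "infinite (Field \<kappa>)" and "regularCard \<kappa>"
    and "Card_order \<Lambda>" and "infinite (Field \<Lambda>)" and "\<kappa> \<le>o \<Lambda>"
    and "X \<subseteq> seqs \<kappa> \<Lambda>" and "weight T \<le>o \<Lambda>"
    and "weak_measure_space \<Lambda> T \<MM> \<mu>" and "continuous_measure T \<MM> \<mu>"
    and "\<forall>A\<in>\<MM>. \<forall>B\<in>\<MM>. A \<inter> B \<in> \<MM>"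
  shows "\<exists>\<P>. partition_on X \<P> \<and> (\<forall>P\<in>\<P>. openin T P \<and> closedin T P) \<and>
     (\<forall>P\<in>\<P>.
        weak_measure_space \<Lambda> (subtopology T P) (restrict_sets \<MM> P) (restrict_measure \<MM> \<mu> P) \<and>
        continuous_measure (subtopology T P) (restrict_sets \<MM> P) (restrict_measure \<MM> \<mu> P) \<and>
        Dirac_measure (cardSuc natLeq) (subtopology T P) (restrict_measure \<MM> \<mu> P)) \<and>
     (\<forall>M\<in>\<MM>.
        is_set_sum \<Lambda> (\<lambda>P. the (restrict_measure \<MM> \<mu> P (M \<inter> P))) \<P> (the (\<mu> M)))"
proof -
  have wo: "Well_order \<kappa>" using \<open>Card_order \<kappa>\<close> by (simp add: card_order_on_def)
  have ne: "Field \<kappa> \<noteq> {}" using \<open>infinite (Field \<kappa>)\<close> by auto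
  have T: "topspace T = X"
    using topspace_bounded_topology[OF ne] \<open>X \<subseteq> seqs \<kappa> \<Lambda>\<close> by (auto simp: T_def)
  have "A \<inter> B \<in> \<MM>" if "A \<in> \<MM>" "B \<in> \<MM>" for A B
    using that \<open>\<forall>A\<in>\<MM>. \<forall>B\<in>\<MM>. A \<inter> B \<in> \<MM>\<close> by blast
  \<comment> \<open>The tree consists of the traces on \<open>X\<close> of the cones, with the bound
    of the fixed initial segment as the level.\<close>
  interpret tree_measure \<Lambda> T \<MM> \<mu> \<kappa> "\<lambda>a x. X \<inter> seq_cone \<kappa> \<Lambda> a x"
  proof
    show "|Field \<kappa>| \<le>o \<Lambda>"
      using card_of_Field_ordIso[OF \<open>Card_order \<kappa>\<close>] \<open>\<kappa> \<le>o \<Lambda>\<close> ordIso_ordLeq_trans by blast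
    show "openin T (X \<inter> seq_cone \<kappa> \<Lambda> a x)" if "x \<in> topspace T" "a \<in> Field \<kappa>" for x a
    proof -
      have "x \<in> seqs \<kappa> \<Lambda>" using that(1) \<open>X \<subseteq> seqs \<kappa> \<Lambda>\<close> unfolding T by blast
      then show ?thesis
        unfolding T_def using that(2) by (intro openin_subtopology_Int2 openin_seq_cone)
    qed
    show "x \<in> X \<inter> seq_cone \<kappa> \<Lambda> a x" if "x \<in> topspace T" for x a
      using that \<open>X \<subseteq> seqs \<kappa> \<Lambda>\<close> unfolding T by (auto intro: mem_seq_cone_self)
    show "X \<inter> seq_cone \<kappa> \<Lambda> a y = X \<inter> seq_cone \<kappa> \<Lambda> a x" if "y \<in> X \<inter> seq_cone \<kappa> \<Lambda> a x" for x y a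
      using that seq_cone_eq[of y \<kappa> \<Lambda> a x] by simp
    show "X \<inter> seq_cone \<kappa> \<Lambda> b x \<subseteq> X \<inter> seq_cone \<kappa> \<Lambda> a x" if "(a, b) \<in> \<kappa>" for a b x
      using seq_cone_antimono[OF wo that] by blast
    show "\<exists>a\<in>Field \<kappa>. X \<inter> seq_cone \<kappa> \<Lambda> a x \<subseteq> U" if U: "openin T U" "x \<in> U" for U x
    proof -
      obtain W where "openin (bounded_topology \<kappa> \<Lambda>) W" "U = W \<inter> X"
        using U(1) by (auto simp: T_def openin_subtopology)
      moreover from this have "\<exists>a\<in>Field \<kappa>. seq_cone \<kappa> \<Lambda> a x \<subseteq> W"
        using U(2) by (intro bounded_topology_nbhd wo ne) auto
      ultimately show ?thesis by blast
    qed
  qed (fact | rule wo)+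
  show ?thesis using Dirac_partition unfolding T .
qed

end
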